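(* Let $K\ge 2$, $n\ge 1$, $\tau\in[0,1]$ and let $\tilde g_1,\dots,\tilde g_K\in\mathbb{R}^n$. Suppose $F_\tau\neq\emptyset$. Then the PCD direction $\tilde d^*$ is the Euclidean projection of $\tilde g_1$ onto $F_\tau$, i.e. $\tilde d^*=\mathrm{Proj}_{F_\tau}(\tilde g_1)$. Equivalently (i.e. $\tilde d^*$ is the vector in $\mathbb{R}^n$ characterized by the following), there exist multipliers $\mu_j^*\ge 0$, $j\in\{2,\dots,K\}$, such that $$\tilde d^*=\tilde g_1+\sum_{j=2}^K\mu_j^*\,\tilde g_j,$$ with primal feasibility $\tilde g_j^\top\tilde d^*\ge\tau\|\tilde g_j\|^2$ and complementary slackness $\mu_j^*\bigl(\tilde g_j^\top\tilde d^*-\tau\|\tilde g_j\|^2\bigr)=0$ for all $j\in\{2,\dots,K\}$.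
   Context: $\|\cdot\|$ is the Euclidean norm. The vectors $\tilde g_1$ (primary) and $\tilde g_2,\dots,\tilde g_K$ (secondary) are normalized (sub)gradients; here they are treated as given vectors in $\mathbb{R}^n$. The feasible set is $F_\tau=\bigcap_{j=2}^K\{d\in\mathbb{R}^n:\tilde g_j^\top d\ge\tau\|\tilde g_j\|^2\}$. The PCD direction is the solution of the quadratic program $\tilde d^*=\arg\min_{d\in F_\tau}\|d-\tilde g_1\|^2$. *)

theory Defs
  imports "HOL-Analysis.Analysis"
begin

definition feasible_set :: "nat \<Rightarrow> real \<Rightarrow> (nat \<Rightarrow> real ^ 'n) \<Rightarrow> (real ^ 'n) set" where
  "feasible_set K \<tau> g = (\<Inter>j\<in>{2..K}. {d. g j \<bullet> d \<ge> \<tau> * (norm (g j))\<^sup>2})"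

definition pcd_objective :: "(nat \<Rightarrow> real ^ 'n) \<Rightarrow> real ^ 'n \<Rightarrow> real" where
  "pcd_objective g d = (norm (d - g 1))\<^sup>2"

text \<open>
  The constant \<^const>\<open>arg_min\<close> selects some minimizer and is unspecified when there is none, so
  statements about the solution of the quadratic program should also assert that there is
  exactly one minimizer.
\<close>

definition pcd_direction :: "nat \<Rightarrow> real \<Rightarrow> (nat \<Rightarrow> real ^ 'n) \<Rightarrow> real ^ 'n" where
  "pcd_direction K \<tau> g = arg_min (pcd_objective g) (\<lambda>d. d \<in> feasible_set K \<tau> g)"

end

theory Submission
  imports Defs
begin

text \<open>
  A minimizer of the distance over a closed convex set is unique and is the closest point. At the
  closest point, moving along a direction on which all active constraints are nonnegative stays
  feasible for a short time, so the residual has nonnegative inner product with it; Farkas' lemma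
  then writes the residual as a nonnegative combination of the active constraint vectors.
  Conversely, multipliers with complementary slackness give the variational inequality that
  characterizes the projection.
\<close>

lemma convex_cone_nonneg_combinations:
  "convex_cone {\<Sum>j\<in>J. \<mu> j *\<^sub>R a j |\<mu> :: 'i \<Rightarrow> real. \<forall>j\<in>J. 0 \<le> \<mu> j}" (is "convex_cone ?C")
  unfolding convex_cone_iff
proof (intro conjI ballI allI impI)
  show "0 \<in> ?C"
    by (auto intro!: exI[of _ "\<lambda>_. 0"])
next
  fix x y assume "x \<in> ?C" "y \<in> ?C"
  then obtain \<mu> \<nu> where "\<forall>j\<in>J. 0 \<le> \<mu> j" "x = (\<Sum>j\<in>J. \<mu> j *\<^sub>R a j)"
    and "\<forall>j\<in>J. 0 \<le> \<nu> j" "y = (\<Sum>j\<in>J. \<nu> j *\<^sub>R a j)"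
    by blast
  then show "x + y \<in> ?C"
    by (auto intro!: exI[of _ "\<lambda>j. \<mu> j + \<nu> j"] simp: scaleR_add_left sum.distrib)
next
  fix x and c :: real assume "x \<in> ?C" "0 \<le> c"
  then obtain \<mu> where "\<forall>j\<in>J. 0 \<le> \<mu> j" "x = (\<Sum>j\<in>J. \<mu> j *\<^sub>R a j)"
    by blast
  with \<open>0 \<le> c\<close> show "c *\<^sub>R x \<in> ?C"
    by (auto intro!: exI[of _ "\<lambda>j. c * \<mu> j"] simp: scaleR_sum_right)
qed

text \<open>The hull is the least convex cone over the generators, and each generator is itself a
  combination with a unit coefficient. This turns membership in the hull into explicit
  multipliers.\<close>

lemma convex_cone_hull_image_subset:
  assumes "finite J"
  shows "convex_cone hull (a ` J)
    \<subseteq> {\<Sum>j\<in>J. \<mu> j *\<^sub>R a j |\<mu> :: 'i \<Rightarrow> real. \<forall>j\<in>J. 0 \<le> \<mu> j}"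
proof (rule hull_minimal, rule image_subsetI)
  fix i assume "i \<in> J"
  with assms have "a i = (\<Sum>j\<in>J. (if j = i then 1 else 0) *\<^sub>R a j)"
    by (simp add: if_distrib[of "\<lambda>c. c *\<^sub>R _"] cong: if_cong)
  then show "a i \<in> {\<Sum>j\<in>J. \<mu> j *\<^sub>R a j |\<mu> :: 'i \<Rightarrow> real. \<forall>j\<in>J. 0 \<le> \<mu> j}"
    by (intro CollectI exI[of _ "\<lambda>j. if j = i then 1 else 0"]) simp
qed (rule convex_cone_nonneg_combinations)

text \<open>A finitely generated cone is closed, so a point \<open>w\<close> outside it can be
  strictly separated from it. The normal of the separating hyperplane is nonnegative on all
  generators but negative on \<open>w\<close>, against \<open>polar\<close>.\<close>

lemma Farkas:
  fixes a :: "'i \<Rightarrow> 'a::euclidean_space"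
  assumes "finite J"
    and polar: "\<And>h. (\<And>j. j \<in> J \<Longrightarrow> 0 \<le> a j \<bullet> h) \<Longrightarrow> 0 \<le> w \<bullet> h"
  obtains \<mu> :: "'i \<Rightarrow> real" where "\<And>j. j \<in> J \<Longrightarrow> 0 \<le> \<mu> j" "w = (\<Sum>j\<in>J. \<mu> j *\<^sub>R a j)"
proof -
  let ?H = "convex_cone hull (a ` J)"
  have "w \<in> ?H"
  proof (rule ccontr)
    assume "w \<notin> ?H"
    moreover have "closed ?H"
      using \<open>finite J\<close> by (simp add: closed_convex_cone_hull)
    ultimately obtain h b where h: "h \<bullet> w < b" "\<forall>x\<in>?H. h \<bullet> x > b"
      using separating_hyperplane_closed_point[OF convex_convex_cone_hull] by blast
    \<comment> \<open>The cone contains the origin, where the functional vanishes.\<close>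
    have "b < 0"
      using h(2) convex_cone_hull_contains_0 by force
    have "0 \<le> a j \<bullet> h" if "j \<in> J" for j
    proof (rule ccontr)
      assume neg: "\<not> 0 \<le> a j \<bullet> h"
      with \<open>b < 0\<close> have "0 \<le> b / (a j \<bullet> h)"
        by (simp add: divide_nonpos_neg)
      \<comment> \<open>The factor is chosen so that this point of the cone lies exactly on the
        hyperplane at level \<open>b\<close>, which strict separation forbids.\<close>
      then have "(b / (a j \<bullet> h)) *\<^sub>R a j \<in> ?H"
        using that by (simp add: convex_cone_hull_mul hull_inc)
      with h(2) have "b < h \<bullet> ((b / (a j \<bullet> h)) *\<^sub>R a j)"
        by blast
      with neg show False
        by (simp add: inner_commute)
    qed
    with polar[of h] h(1) \<open>b < 0\<close> show False
      by (simp add: inner_commute)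
  qed
  with convex_cone_hull_image_subset[OF \<open>finite J\<close>] that show thesis
    by blast
qed

text \<open>Expanding the squared distance from \<open>x\<close> to \<open>y\<close> around
  \<open>d\<close> leaves a cross term that \<open>var\<close> makes nonnegative, so no
  \<open>y\<close> is closer than \<open>d\<close>.\<close>

lemma closest_point_characterization:
  fixes x :: "'a::euclidean_space"
  assumes "convex S" "closed S" "d \<in> S" and var: "\<And>y. y \<in> S \<Longrightarrow> 0 \<le> (d - x) \<bullet> (y - d)"
  shows "d = closest_point S x"
proof (rule closest_point_unique[OF assms(1-3)], rule ballI)
  fix y assume "y \<in> S"
  have "(norm (y - x))\<^sup>2 = (norm (d - x))\<^sup>2 + 2 * ((d - x) \<bullet> (y - d)) + (norm (y - d))\<^sup>2"
    by (simp add: power2_norm_eq_inner inner_diff_left inner_diff_right inner_commute)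
  then have "(norm (d - x))\<^sup>2 \<le> (norm (y - x))\<^sup>2"
    using var[OF \<open>y \<in> S\<close>] by simp
  then have "norm (d - x) \<le> norm (y - x)"
    by (rule power2_le_imp_le) simp
  then show "dist x d \<le> dist x y"
    by (simp add: dist_norm norm_minus_commute)
qed

lemma closest_point_polyhedron_iff:
  fixes x :: "'a::euclidean_space" and a :: "'i \<Rightarrow> 'a" and b :: "'i \<Rightarrow> real"
  assumes "finite J" and S: "S = (\<Inter>j\<in>J. {d. a j \<bullet> d \<ge> b j})" and "S \<noteq> {}"
  shows "d = closest_point S x \<longleftrightarrow>
    (\<exists>\<mu> :: 'i \<Rightarrow> real. (\<forall>j\<in>J. \<mu> j \<ge> 0) \<and> d = x + (\<Sum>j\<in>J. \<mu> j *\<^sub>R a j)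
      \<and> (\<forall>j\<in>J. a j \<bullet> d \<ge> b j) \<and> (\<forall>j\<in>J. \<mu> j * (a j \<bullet> d - b j) = 0))"
    (is "_ \<longleftrightarrow> (\<exists>\<mu>. ?KKT \<mu>)")
proof -
  have cvx: "convex S" and cl: "closed S"
    unfolding S by (auto intro!: convex_INT closed_INT convex_halfspace_ge closed_halfspace_ge)
  show ?thesis
  proof
    assume d: "d = closest_point S x"
    have "d \<in> S"
      unfolding d using cl \<open>S \<noteq> {}\<close> by (rule closest_point_in_set)
    then have feas: "b j \<le> a j \<bullet> d" if "j \<in> J" for j
      using that by (simp add: S)
    define A where "A = {j\<in>J. a j \<bullet> d = b j}"
    have "finite A"
      using \<open>finite J\<close> by (simp add: A_def)
    \<comment> \<open>This is the polarity condition of \<open>Farkas\<close> for the residual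
      \<open>d - x\<close> and the active constraints.\<close>
    have "0 \<le> (d - x) \<bullet> h" if h: "\<And>j. j \<in> A \<Longrightarrow> 0 \<le> a j \<bullet> h" for h
    proof -
      \<comment> \<open>An active constraint cannot decrease along \<open>h\<close>; an inactive one
        has positive slack, which survives small steps by continuity. Finiteness of \<open>J\<close>
        then gives a common step length.\<close>
      have "\<forall>\<^sub>F t in at_right 0. b j \<le> a j \<bullet> (d + t *\<^sub>R h)" if "j \<in> J" for j
      proof (cases "j \<in> A")
        case True
        show ?thesis
          using eventually_at_right_less[of "0::real"]
        proof eventually_elim
          case (elim t)
          with h[OF True] feas[OF that] show ?case
            by (simp add: inner_add_right add_increasing2)
        qed
      next
        case False
        with feas[OF that] that have "b j < a j \<bullet> d"
          by (fastforce simp: A_def)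
        moreover have "((\<lambda>t. a j \<bullet> (d + t *\<^sub>R h)) \<longlongrightarrow> a j \<bullet> (d + 0 *\<^sub>R h)) (at_right 0)"
          by (intro tendsto_intros)
        ultimately have "\<forall>\<^sub>F t in at_right 0. b j < a j \<bullet> (d + t *\<^sub>R h)"
          by (simp add: order_tendstoD)
        then show ?thesis
          by (rule eventually_mono) simp
      qed
      then have "\<forall>\<^sub>F t in at_right 0. d + t *\<^sub>R h \<in> S"
        using \<open>finite J\<close> by (simp add: S eventually_ball_finite)
      with eventually_at_right_less[of "0::real"]
      have "\<forall>\<^sub>F t in at_right 0. 0 < t \<and> d + t *\<^sub>R h \<in> S"
        by (rule eventually_conj)
      then obtain t :: real where t: "0 < t" "d + t *\<^sub>R h \<in> S"
        using eventually_happens'[OF trivial_limit_at_right_real] by blast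
      \<comment> \<open>The variational inequality of the projection, tested at the feasible point
        just found; dividing by \<open>t > 0\<close> gives the claim.\<close>
      have "(x - d) \<bullet> (d + t *\<^sub>R h - d) \<le> 0"
        unfolding d by (rule closest_point_dot[OF cvx cl t(2)[unfolded d]])
      with t(1) show ?thesis
        by (simp add: inner_diff_left mult_le_0_iff)
    qed
    then obtain \<mu> where \<mu>: "\<And>j. j \<in> A \<Longrightarrow> 0 \<le> \<mu> j" "d - x = (\<Sum>j\<in>A. \<mu> j *\<^sub>R a j)"
      using Farkas[OF \<open>finite A\<close>] by blast
    \<comment> \<open>Extension by zero yields complementary slackness: on \<open>A\<close> the
      slack vanishes, off \<open>A\<close> the multiplier does.\<close>
    define \<nu> where "\<nu> j = (if j \<in> A then \<mu> j else 0)" for j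
    have "(\<Sum>j\<in>A. \<mu> j *\<^sub>R a j) = (\<Sum>j\<in>J. \<nu> j *\<^sub>R a j)"
      using \<open>finite J\<close> by (intro sum.mono_neutral_cong_left) (auto simp: A_def \<nu>_def)
    with \<mu>(2) have "d = x + (\<Sum>j\<in>J. \<nu> j *\<^sub>R a j)"
      by (simp add: algebra_simps)
    moreover have "\<forall>j\<in>J. 0 \<le> \<nu> j" "\<forall>j\<in>J. \<nu> j * (a j \<bullet> d - b j) = 0"
      using \<mu>(1) by (auto simp: \<nu>_def A_def)
    ultimately have "?KKT \<nu>"
      using feas by blast
    then show "\<exists>\<mu>. ?KKT \<mu>"
      by (rule exI[of ?KKT])
  next
    assume "\<exists>\<mu>. ?KKT \<mu>"
    then obtain \<mu> where \<mu>: "\<And>j. j \<in> J \<Longrightarrow> 0 \<le> \<mu> j" "d = x + (\<Sum>j\<in>J. \<mu> j *\<^sub>R a j)"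
      and feas: "\<And>j. j \<in> J \<Longrightarrow> b j \<le> a j \<bullet> d"
      and slack: "\<And>j. j \<in> J \<Longrightarrow> \<mu> j * (a j \<bullet> d - b j) = 0"
      by blast
    show "d = closest_point S x"
    proof (rule closest_point_characterization[OF cvx cl])
      show "d \<in> S"
        using feas by (simp add: S)
    next
      fix y assume "y \<in> S"
      have "(d - x) \<bullet> (y - d) = (\<Sum>j\<in>J. \<mu> j * (a j \<bullet> (y - d)))"
        by (subst \<mu>(2)) (simp add: inner_sum_left)
      \<comment> \<open>Complementary slackness allows \<open>a j \<bullet> d\<close> to be replaced
        by \<open>b j\<close> in each term, and feasibility of \<open>y\<close> then gives the
        sign.\<close>
      also have "\<dots> = (\<Sum>j\<in>J. \<mu> j * (a j \<bullet> y - b j))"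
        using slack by (intro sum.cong refl) (fastforce simp: inner_diff_right)
      also have "\<dots> \<ge> 0"
        using \<mu>(1) \<open>y \<in> S\<close> by (intro sum_nonneg mult_nonneg_nonneg) (auto simp: S)
      finally show "0 \<le> (d - x) \<bullet> (y - d)" .
    qed
  qed
qed

text \<open>Squaring preserves the order of norms, so both sides speak of nearest points. Closedness
  gives existence and convexity uniqueness; the equivalence carries both.\<close>

lemma is_arg_min_dist_iff_closest_point:
  fixes x :: "'a::euclidean_space"
  assumes "convex S" "closed S" "S \<noteq> {}"
  shows "is_arg_min (\<lambda>d. (norm (d - x))\<^sup>2) (\<lambda>d. d \<in> S) d \<longleftrightarrow> d = closest_point S x"
proof -
  have "is_arg_min (\<lambda>d. (norm (d - x))\<^sup>2) (\<lambda>d. d \<in> S) d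
      \<longleftrightarrow> d \<in> S \<and> (\<forall>y\<in>S. dist x d \<le> dist x y)"
    by (auto simp: is_arg_min_linorder dist_norm norm_minus_commute)
  then show ?thesis
    using assms closest_point_unique[OF assms(1,2)] closest_point_exists[OF assms(2,3)] by metis
qed

theorem theorem4p2:
  fixes g :: "nat \<Rightarrow> real ^ 'n" and K :: nat and \<tau> :: real
  assumes "K \<ge> 2" and "0 \<le> \<tau>" and "\<tau> \<le> 1"
    and "feasible_set K \<tau> g \<noteq> {}"
  shows "(\<exists>!d. is_arg_min (pcd_objective g) (\<lambda>d. d \<in> feasible_set K \<tau> g) d)
    \<and> pcd_direction K \<tau> g = closest_point (feasible_set K \<tau> g) (g 1)
    \<and> (\<forall>d. d = pcd_direction K \<tau> g \<longleftrightarrow>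
          (\<exists>\<mu> :: nat \<Rightarrow> real.
              (\<forall>j\<in>{2..K}. \<mu> j \<ge> 0)
            \<and> d = g 1 + (\<Sum>j=2..K. \<mu> j *\<^sub>R g j)
            \<and> (\<forall>j\<in>{2..K}. g j \<bullet> d \<ge> \<tau> * (norm (g j))\<^sup>2)
            \<and> (\<forall>j\<in>{2..K}. \<mu> j * (g j \<bullet> d - \<tau> * (norm (g j))\<^sup>2) = 0)))"
proof -
  let ?F = "feasible_set K \<tau> g"
  have "convex ?F" "closed ?F"
    unfolding feasible_set_def
    by (auto intro!: convex_INT closed_INT convex_halfspace_ge closed_halfspace_ge)
  then have min: "is_arg_min (pcd_objective g) (\<lambda>d. d \<in> ?F) d \<longleftrightarrow> d = closest_point ?F (g 1)" for d
    using is_arg_min_dist_iff_closest_point[OF _ _ assms(4), of "g 1" d]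
    by (simp add: pcd_objective_def[abs_def])
  \<comment> \<open>By \<open>min\<close> the predicate behind the choice in \<open>arg_min\<close>
    is equality with the projection, so the choice is determined.\<close>
  then have dir: "pcd_direction K \<tau> g = closest_point ?F (g 1)"
    by (simp add: pcd_direction_def arg_min_def)
  show ?thesis
    \<comment> \<open>Unique existence becomes trivial after this rewriting. The multiplier
      characterization is the polyhedral case with index set \<open>{2..K}\<close> and bounds
      \<open>\<tau> * (norm (g j))\<^sup>2\<close>.\<close>
    unfolding dir min
    by (intro conjI allI closest_point_polyhedron_iff finite_atLeastAtMost feasible_set_def assms(4))
      simp_all
qed

end
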